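(* Let $(A,\mu,\alpha,\beta)$ be a BiHom-associative algebra over a field $k$, with $\mu(x\otimes y)=xy$, let $\lambda\in k$, and let $R:A\to A$ be a Rota-Baxter operator of weight $\lambda$ for $(A,\mu)$ such that $R\circ\alpha=\alpha\circ R$ and $R\circ\beta=\beta\circ R$. Define a new multiplication on $A$ by $x*y=xR(y)+R(x)y+\lambda xy$ for all $x,y\in A$. Then $(A,*,\alpha,\beta)$ is a BiHom-associative algebra.
   Context: Everything is over a fixed field $k$; multiplications are linear maps $A\otimes A\to A$, and no unit is assumed. A BiHom-associative algebra is a 4-tuple $(A,\mu,\alpha,\beta)$ with $A$ a linear space, $\alpha,\beta:A\to A$ and $\mu:A\otimes A\to A$, $\mu(x\otimes y)=xy$, linear maps such that for all $x,y,z\in A$: $\alpha\circ\beta=\beta\circ\alpha$; $\alpha(xy)=\alpha(x)\alpha(y)$; $\beta(xy)=\beta(x)\beta(y)$; $\alpha(x)(yz)=(xy)\beta(z)$. A Rota-Baxter operator of weight $\lambda\in k$ for $(A,\mu)$ is a linear map $R:A\to A$ with $R(x)R(y)=R(R(x)y+xR(y)+\lambda xy)$ for all $x,y\in A$. *)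

theory Defs
  imports Complex_Main
begin

text \<open>Linear maps \<open>A \<otimes> A \<rightarrow> A\<close> are represented as curried maps that are linear in each
  argument. Neither associativity nor a unit is assumed.\<close>

locale nonassoc_algebra = vector_space scale
  for scale :: "'k::field \<Rightarrow> 'a::ab_group_add \<Rightarrow> 'a" +
  fixes mul :: "'a \<Rightarrow> 'a \<Rightarrow> 'a"
  assumes linear_mul_left: "\<And>y. Vector_Spaces.linear scale scale (\<lambda>x. mul x y)"
    and linear_mul_right: "\<And>x. Vector_Spaces.linear scale scale (\<lambda>y. mul x y)"

locale bihom_associative_algebra = nonassoc_algebra scale mul
  for scale :: "'k::field \<Rightarrow> 'a::ab_group_add \<Rightarrow> 'a"
    and mul :: "'a \<Rightarrow> 'a \<Rightarrow> 'a" +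
  fixes \<alpha> \<beta> :: "'a \<Rightarrow> 'a"
  assumes linear_alpha: "Vector_Spaces.linear scale scale \<alpha>"
    and linear_beta: "Vector_Spaces.linear scale scale \<beta>"
    and alpha_beta_commute: "\<alpha> \<circ> \<beta> = \<beta> \<circ> \<alpha>"
    and alpha_mul: "\<And>x y. \<alpha> (mul x y) = mul (\<alpha> x) (\<alpha> y)"
    and beta_mul: "\<And>x y. \<beta> (mul x y) = mul (\<beta> x) (\<beta> y)"
    and bihom_assoc: "\<And>x y z. mul (\<alpha> x) (mul y z) = mul (mul x y) (\<beta> z)"

locale rota_baxter_operator = nonassoc_algebra scale mul
  for scale :: "'k::field \<Rightarrow> 'a::ab_group_add \<Rightarrow> 'a"
    and mul :: "'a \<Rightarrow> 'a \<Rightarrow> 'a" +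
  fixes wt :: 'k and R :: "'a \<Rightarrow> 'a"
  assumes linear_R: "Vector_Spaces.linear scale scale R"
    and rota_baxter:
      "\<And>x y. mul (R x) (R y) = R (mul (R x) y + mul x (R y) + scale wt (mul x y))"

end

theory Submission
  imports Defs
begin

text \<open>Write \<open>xy\<close> for the given product and \<open>x * y = x R(y) + R(x) y + \<lambda> xy\<close> for the new one,
  with \<open>\<lambda>\<close> the weight.
  The Rota--Baxter identity says exactly that \<open>R(x * y) = R(x) R(y)\<close>, so \<open>R\<close> applied to a
  \<open>*\<close>-product can be pushed inside. Since \<open>R\<close> commutes with \<open>\<alpha>\<close> and \<open>\<beta>\<close>, both sides of the
  BiHom-associativity law for \<open>*\<close> then expand into seven terms, one for each nonempty subset of
  the three arguments: the arguments in the subset appear bare, the others under \<open>R\<close>, and the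
  coefficient is \<open>\<lambda>\<close> to the size of the subset minus one. Corresponding terms agree by
  BiHom-associativity of the given product; this is \<open>rb_mul_bihom_assoc\<close>. Multiplicativity of
  \<open>\<alpha>\<close> and \<open>\<beta>\<close> for \<open>*\<close> holds term by term, because each of them is a linear endomorphism
  of the given product commuting with \<open>R\<close>; this is \<open>rb_mul_hom\<close>.\<close>

lemma linear_add_scale:
  assumes "Vector_Spaces.linear s t f"
  shows "f (x + y) = f x + f y" and "f (s c x) = t c (f x)"
  using assms by (auto simp: Vector_Spaces.linear_iff)

context rota_baxter_operator
begin

lemmas mul_simps =
  linear_add_scale[OF linear_mul_left] linear_add_scale[OF linear_mul_right]

lemmas R_simps = linear_add_scale[OF linear_R]

definition rb_mul :: "'a \<Rightarrow> 'a \<Rightarrow> 'a"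
  where "rb_mul x y = mul x (R y) + mul (R x) y + scale wt (mul x y)"

lemma R_rb_mul: "R (rb_mul x y) = mul (R x) (R y)"
  by (simp add: rb_mul_def rota_baxter add.commute)

lemma nonassoc_algebra_rb_mul: "nonassoc_algebra scale rb_mul"
  by unfold_locales
    (simp_all add: rb_mul_def mul_simps R_simps scale_right_distrib scale_left_commute)

lemma rb_mul_hom:
  assumes "Vector_Spaces.linear scale scale f"
    and "\<And>x y. f (mul x y) = mul (f x) (f y)"
    and "\<And>x. R (f x) = f (R x)"
  shows "f (rb_mul x y) = rb_mul (f x) (f y)"
  by (simp add: rb_mul_def linear_add_scale[OF assms(1)] assms(2,3))

text \<open>On the left the factor \<open>R(y * z)\<close> becomes \<open>R(y) R(z)\<close>, on the right \<open>R(x * y)\<close> becomes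
  \<open>R(x) R(y)\<close>; commutation of \<open>R\<close> with \<open>\<alpha>\<close> on the left and with \<open>\<beta>\<close> on the right then brings
  all terms into the shape of the hypothesis \<open>assoc\<close>, with each argument either bare or under
  \<open>R\<close>.\<close>

lemma rb_mul_bihom_assoc:
  assumes assoc: "\<And>x y z. mul (a x) (mul y z) = mul (mul x y) (b z)"
    and R_a: "\<And>x. R (a x) = a (R x)"
    and R_b: "\<And>x. R (b x) = b (R x)"
  shows "rb_mul (a x) (rb_mul y z) = rb_mul (rb_mul x y) (b z)"
proof -
  have "rb_mul (a x) (rb_mul y z) =
      mul (a x) (mul (R y) (R z)) + mul (a (R x)) (rb_mul y z) + scale wt (mul (a x) (rb_mul y z))"
    by (simp add: rb_mul_def[of "a x"] R_rb_mul R_a)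
  also have "\<dots> =
      mul (rb_mul x y) (b (R z)) + mul (mul (R x) (R y)) (b z) + scale wt (mul (rb_mul x y) (b z))"
    by (simp add: rb_mul_def mul_simps assoc scale_right_distrib add_ac)
  also have "\<dots> = rb_mul (rb_mul x y) (b z)"
    by (simp add: rb_mul_def[of "rb_mul x y"] R_rb_mul R_b)
  finally show ?thesis .
qed

end

theorem corollary3p6:
  fixes scale :: "'k::field \<Rightarrow> 'a::ab_group_add \<Rightarrow> 'a"
    and mul :: "'a \<Rightarrow> 'a \<Rightarrow> 'a"
    and \<alpha> \<beta> R :: "'a \<Rightarrow> 'a"
    and wt :: 'k
  assumes "bihom_associative_algebra scale mul \<alpha> \<beta>"
    and "rota_baxter_operator scale mul wt R"
    and "R \<circ> \<alpha> = \<alpha> \<circ> R"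
    and "R \<circ> \<beta> = \<beta> \<circ> R"
  shows "bihom_associative_algebra scale
    (\<lambda>x y. mul x (R y) + mul (R x) y + scale wt (mul x y)) \<alpha> \<beta>"
proof -
  interpret B: bihom_associative_algebra scale mul \<alpha> \<beta> by fact
  interpret RB: rota_baxter_operator scale mul wt R by fact
  have R_\<alpha>: "R (\<alpha> x) = \<alpha> (R x)" and R_\<beta>: "R (\<beta> x) = \<beta> (R x)" for x
    using assms(3,4) by (simp_all add: fun_eq_iff)
  have "bihom_associative_algebra scale RB.rb_mul \<alpha> \<beta>"
  proof (intro bihom_associative_algebra.intro bihom_associative_algebra_axioms.intro)
    show "nonassoc_algebra scale RB.rb_mul"
      by (rule RB.nonassoc_algebra_rb_mul)
    show "\<alpha> (RB.rb_mul x y) = RB.rb_mul (\<alpha> x) (\<alpha> y)" for x y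
      by (rule RB.rb_mul_hom[OF B.linear_alpha B.alpha_mul R_\<alpha>])
    show "\<beta> (RB.rb_mul x y) = RB.rb_mul (\<beta> x) (\<beta> y)" for x y
      by (rule RB.rb_mul_hom[OF B.linear_beta B.beta_mul R_\<beta>])
    show "RB.rb_mul (\<alpha> x) (RB.rb_mul y z) = RB.rb_mul (RB.rb_mul x y) (\<beta> z)" for x y z
      by (rule RB.rb_mul_bihom_assoc[OF B.bihom_assoc R_\<alpha> R_\<beta>])
  qed (fact B.linear_alpha B.linear_beta B.alpha_beta_commute)+
  then show ?thesis
    by (simp add: RB.rb_mul_def[abs_def])
qed

end
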